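(* Let $\Gamma$ be a group with conjugates in commuting $\mathbb{Z}$-conjugate. Then $\Gamma$ has commuting $\mathbb{Z}$-conjugates.
   Context: Groups are abstract discrete groups, and we write ${}^t g = t g t^{-1}$ and ${}^t H = tHt^{-1}$. A group $\Gamma$ has *conjugates in commuting $\mathbb{Z}$-conjugate* if there exist a subgroup $\Lambda \leq \Gamma$ and an element $t \in \Gamma$ such that: (1) $[\Lambda, {}^{t^p}\Lambda] = 1$ for all integers $p \geq 1$; (2) every finite subset of $\Gamma$ is contained in a conjugate of $\Lambda$ in $\Gamma$. A group $\Gamma$ has *commuting $\mathbb{Z}$-conjugates* if for every finitely generated subgroup $H \leq \Gamma$ there exists $t \in \Gamma$ such that $[H, {}^{t^p} H] = 1$ for all integers $p \geq 1$. *)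

theory Defs
  imports "HOL-Algebra.Generated_Groups"
begin

definition conjugate :: "('a, 'b) monoid_scheme \<Rightarrow> 'a \<Rightarrow> 'a \<Rightarrow> 'a" where
  "conjugate G t g = t \<otimes>\<^bsub>G\<^esub> g \<otimes>\<^bsub>G\<^esub> inv\<^bsub>G\<^esub> t"

definition conjugate_set :: "('a, 'b) monoid_scheme \<Rightarrow> 'a \<Rightarrow> 'a set \<Rightarrow> 'a set" where
  "conjugate_set G t H = conjugate G t ` H"

text \<open>The subgroup \<open>[H, K]\<close>, with the same convention for commutators as \<^const>\<open>derived\<close>.\<close>

definition commutator_subgroup :: "('a, 'b) monoid_scheme \<Rightarrow> 'a set \<Rightarrow> 'a set \<Rightarrow> 'a set" where
  "commutator_subgroup G H K =
     generate G (\<Union>h\<in>H. \<Union>k\<in>K. {h \<otimes>\<^bsub>G\<^esub> k \<otimes>\<^bsub>G\<^esub> inv\<^bsub>G\<^esub> h \<otimes>\<^bsub>G\<^esub> inv\<^bsub>G\<^esub> k})"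

definition finitely_generated_subgroup :: "'a set \<Rightarrow> ('a, 'b) monoid_scheme \<Rightarrow> bool" where
  "finitely_generated_subgroup H G \<longleftrightarrow>
     subgroup H G \<and> (\<exists>S. finite S \<and> S \<subseteq> carrier G \<and> H = generate G S)"

definition conjugates_in_commuting_Z_conjugate :: "('a, 'b) monoid_scheme \<Rightarrow> bool" where
  "conjugates_in_commuting_Z_conjugate G \<longleftrightarrow>
     (\<exists>L t. subgroup L G \<and> t \<in> carrier G \<and>
        (\<forall>p::int. p \<ge> 1 \<longrightarrow>
           commutator_subgroup G L (conjugate_set G (t [^]\<^bsub>G\<^esub> p) L) = {\<one>\<^bsub>G\<^esub>}) \<and>
        (\<forall>F. finite F \<and> F \<subseteq> carrier G \<longrightarrow>
           (\<exists>g\<in>carrier G. F \<subseteq> conjugate_set G g L)))"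

definition commuting_Z_conjugates :: "('a, 'b) monoid_scheme \<Rightarrow> bool" where
  "commuting_Z_conjugates G \<longleftrightarrow>
     (\<forall>H. finitely_generated_subgroup H G \<longrightarrow>
        (\<exists>t\<in>carrier G. \<forall>p::int. p \<ge> 1 \<longrightarrow>
           commutator_subgroup G H (conjugate_set G (t [^]\<^bsub>G\<^esub> p) H) = {\<one>\<^bsub>G\<^esub>}))"

end

theory Submission
  imports Defs
begin

text \<open>If a conjugate \<open>g\<Lambda>g\<inverse>\<close> contains the finitely many generators of \<open>H\<close>, it contains \<open>H\<close>, and
  conjugating the commutation relations of \<open>\<Lambda>\<close> by \<open>g\<close> shows that \<open>s = gtg\<inverse>\<close> works for \<open>H\<close>.\<close>

context group
begin

lemma conjugate_closed [simp]:
  "g \<in> carrier G \<Longrightarrow> x \<in> carrier G \<Longrightarrow> conjugate G g x \<in> carrier G"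
  by (simp add: conjugate_def)

lemma conjugate_mult:
  assumes "g \<in> carrier G" "x \<in> carrier G" "y \<in> carrier G"
  shows "conjugate G g (x \<otimes> y) = conjugate G g x \<otimes> conjugate G g y"
proof -
  \<comment> \<open>The inner cancellation, stated in the right-nested form that
    \<open>m_assoc\<close> produces from the product of the two conjugates.\<close>
  have "inv g \<otimes> (g \<otimes> (y \<otimes> inv g)) = y \<otimes> inv g"
    using assms by (simp flip: m_assoc)
  then show ?thesis
    using assms by (simp add: conjugate_def m_assoc)
qed

text \<open>Being a homomorphism yields two facts used later: images of subgroups are subgroups, and
  integer powers are preserved.\<close>

lemma conjugate_hom: "g \<in> carrier G \<Longrightarrow> group_hom G G (conjugate G g)"
  by unfold_locales (auto simp: hom_def conjugate_mult)

lemma conjugate_conjugate: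
  assumes "g \<in> carrier G" "h \<in> carrier G" "x \<in> carrier G"
  shows "conjugate G g (conjugate G h x) = conjugate G (g \<otimes> h) x"
  using assms by (simp add: conjugate_def m_assoc inv_mult_group)

text \<open>Both sides are conjugations of \<open>x\<close> by a product, and the two products agree
  because the trailing \<open>inv g\<close> of \<open>conjugate G g a\<close> cancels against
  \<open>g\<close>.\<close>

lemma conjugate_by_conjugate:
  assumes "g \<in> carrier G" "a \<in> carrier G" "x \<in> carrier G"
  shows "conjugate G (conjugate G g a) (conjugate G g x) = conjugate G g (conjugate G a x)"
proof -
  have "conjugate G g a \<otimes> g = g \<otimes> a"
    using assms by (simp add: conjugate_def m_assoc)
  then show ?thesis
    using assms by (simp add: conjugate_conjugate)
qed

lemma commutator_eq_one_iff:
  assumes "h \<in> carrier G" "k \<in> carrier G"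
  shows "h \<otimes> k \<otimes> inv h \<otimes> inv k = \<one> \<longleftrightarrow> h \<otimes> k = k \<otimes> h"
proof -
  have "h \<otimes> k \<otimes> inv h \<otimes> inv k = (h \<otimes> k) \<otimes> inv (k \<otimes> h)"
    using assms by (simp add: m_assoc inv_mult_group)
  also have "\<dots> = \<one> \<longleftrightarrow> h \<otimes> k = k \<otimes> h"
    using assms by (subst inv_solve_right') auto
  finally show ?thesis .
qed

text \<open>A generated subgroup is trivial exactly when all its generators are. This reduces both
  the hypothesis on \<open>L\<close> and the goal for \<open>H\<close> to elementwise
  commutation.\<close>

lemma commutator_subgroup_trivial_iff:
  assumes "H \<subseteq> carrier G" "K \<subseteq> carrier G"
  shows "commutator_subgroup G H K = {\<one>} \<longleftrightarrow> (\<forall>h\<in>H. \<forall>k\<in>K. h \<otimes> k = k \<otimes> h)"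
proof -
  have eq: "generate G S = {\<one>} \<longleftrightarrow> S \<subseteq> {\<one>}" for S
  proof
    show "generate G S = {\<one>} \<Longrightarrow> S \<subseteq> {\<one>}"
      by (auto dest: generate.incl)
    show "S \<subseteq> {\<one>} \<Longrightarrow> generate G S = {\<one>}"
      \<comment> \<open>Two cases: \<open>S\<close> is empty or \<open>S\<close> is the singleton of
        the identity.\<close>
      using generate_empty generate_one by (auto dest: subset_singletonD)
  qed
  have "h \<otimes> k \<otimes> inv h \<otimes> inv k = \<one> \<longleftrightarrow> h \<otimes> k = k \<otimes> h" if "h \<in> H" "k \<in> K" for h k
    using assms that by (intro commutator_eq_one_iff) auto
  then show ?thesis
    by (simp add: commutator_subgroup_def eq UN_subset_iff)
qed

end

theorem lemma2p23:
  fixes \<Gamma> :: "('a, 'b) monoid_scheme"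
  assumes "group \<Gamma>"
    and "conjugates_in_commuting_Z_conjugate \<Gamma>"
  shows "commuting_Z_conjugates \<Gamma>"
proof -
  interpret group \<Gamma> by fact
  from assms(2) obtain L t where L: "subgroup L \<Gamma>" and t: "t \<in> carrier \<Gamma>"
    and comm: "\<And>p::int. p \<ge> 1 \<Longrightarrow>
      commutator_subgroup \<Gamma> L (conjugate_set \<Gamma> (t [^]\<^bsub>\<Gamma>\<^esub> p) L) = {\<one>\<^bsub>\<Gamma>\<^esub>}"
    and cover: "\<And>F. finite F \<Longrightarrow> F \<subseteq> carrier \<Gamma> \<Longrightarrow> \<exists>g\<in>carrier \<Gamma>. F \<subseteq> conjugate_set \<Gamma> g L"
    unfolding conjugates_in_commuting_Z_conjugate_def by (elim exE conjE) simp
  have LG: "L \<subseteq> carrier \<Gamma>"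
    using L by (rule subgroup.subset)
  have "\<exists>s\<in>carrier \<Gamma>. \<forall>p::int. p \<ge> 1 \<longrightarrow>
      commutator_subgroup \<Gamma> H (conjugate_set \<Gamma> (s [^]\<^bsub>\<Gamma>\<^esub> p) H) = {\<one>\<^bsub>\<Gamma>\<^esub>}"
    if "finitely_generated_subgroup H \<Gamma>" for H
  proof -
    from that obtain S where HG: "H \<subseteq> carrier \<Gamma>"
      and S: "finite S" "S \<subseteq> carrier \<Gamma>" "H = generate \<Gamma> S"
      by (auto simp: finitely_generated_subgroup_def dest: subgroup.subset)
    from cover[OF S(1,2)] obtain g where g: "g \<in> carrier \<Gamma>" and "S \<subseteq> conjugate_set \<Gamma> g L"
      by blast
    interpret conj: group_hom \<Gamma> \<Gamma> "conjugate \<Gamma> g"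
      using g by (rule conjugate_hom)
    \<comment> \<open>The image of \<open>L\<close> is a subgroup containing the generators
      \<open>S\<close>, hence contains all of \<open>H\<close>.\<close>
    have HL: "H \<subseteq> conjugate \<Gamma> g ` L"
      using generate_subgroup_incl[of S "conjugate \<Gamma> g ` L"] conj.subgroup_img_is_subgroup[OF L]
        \<open>S \<subseteq> conjugate_set \<Gamma> g L\<close> S(3) by (simp add: conjugate_set_def)
    define s where "s = conjugate \<Gamma> g t"
    have "commutator_subgroup \<Gamma> H (conjugate_set \<Gamma> (s [^]\<^bsub>\<Gamma>\<^esub> p) H) = {\<one>\<^bsub>\<Gamma>\<^esub>}"
      if p: "p \<ge> 1" for p :: int
    proof -
      have tp: "t [^]\<^bsub>\<Gamma>\<^esub> p \<in> carrier \<Gamma>"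
        using t by simp
      \<comment> \<open>Conjugation by \<open>g\<close> commutes with powers, so the single element
        \<open>s\<close>, chosen before \<open>p\<close>, serves every exponent.\<close>
      have sp: "s [^]\<^bsub>\<Gamma>\<^esub> p = conjugate \<Gamma> g (t [^]\<^bsub>\<Gamma>\<^esub> p)"
        using t by (simp add: s_def conj.hom_int_pow)
      have "h \<otimes>\<^bsub>\<Gamma>\<^esub> conjugate \<Gamma> (s [^]\<^bsub>\<Gamma>\<^esub> p) k = conjugate \<Gamma> (s [^]\<^bsub>\<Gamma>\<^esub> p) k \<otimes>\<^bsub>\<Gamma>\<^esub> h"
        if "h \<in> H" "k \<in> H" for h k
      proof -
        from that HL obtain x y where x: "x \<in> L" "h = conjugate \<Gamma> g x"
          and y: "y \<in> L" "k = conjugate \<Gamma> g y" by blast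
        have xy: "x \<in> carrier \<Gamma>" "y \<in> carrier \<Gamma>"
          using x y LG by auto
        \<comment> \<open>The outer conjugation by \<open>g\<close> is pulled to the front, so that
          both \<open>h\<close> and this element are \<open>g\<close>-conjugates of elements that
          commute by \<open>comm\<close>.\<close>
        have k: "conjugate \<Gamma> (s [^]\<^bsub>\<Gamma>\<^esub> p) k = conjugate \<Gamma> g (conjugate \<Gamma> (t [^]\<^bsub>\<Gamma>\<^esub> p) y)"
          using conjugate_by_conjugate[OF g tp xy(2)] by (simp add: sp y(2))
        have "conjugate_set \<Gamma> (t [^]\<^bsub>\<Gamma>\<^esub> p) L \<subseteq> carrier \<Gamma>"
          using LG tp by (auto simp: conjugate_set_def)
        with comm[OF p] x(1) y(1)
        have "x \<otimes>\<^bsub>\<Gamma>\<^esub> conjugate \<Gamma> (t [^]\<^bsub>\<Gamma>\<^esub> p) y = conjugate \<Gamma> (t [^]\<^bsub>\<Gamma>\<^esub> p) y \<otimes>\<^bsub>\<Gamma>\<^esub> x"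
          by (simp add: commutator_subgroup_trivial_iff[OF LG] conjugate_set_def)
        \<comment> \<open>Apply \<open>conjugate \<Gamma> g\<close> to the relation just obtained;
          the two instances of multiplicativity expand its two sides.\<close>
        then show ?thesis
          using conjugate_mult[OF g xy(1), of "conjugate \<Gamma> (t [^]\<^bsub>\<Gamma>\<^esub> p) y"]
            conjugate_mult[OF g _ xy(1), of "conjugate \<Gamma> (t [^]\<^bsub>\<Gamma>\<^esub> p) y"] xy tp
          by (simp add: k x(2))
      qed
      moreover have "conjugate_set \<Gamma> (s [^]\<^bsub>\<Gamma>\<^esub> p) H \<subseteq> carrier \<Gamma>"
        using HG g tp by (auto simp: conjugate_set_def sp)
      ultimately show ?thesis
        by (simp add: commutator_subgroup_trivial_iff[OF HG] conjugate_set_def)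
    qed
    moreover have "s \<in> carrier \<Gamma>"
      using g t by (simp add: s_def)
    ultimately show ?thesis by blast
  qed
  then show ?thesis
    unfolding commuting_Z_conjugates_def by blast
qed

end
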